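(* Define the minimum achievable peak workload $$\theta^* := \min_{x\in\mathcal X}\ \max_{i\in\mathcal I}\frac{a_i(x)}{\mu_i}.$$ Then $$\theta^*=\max_{\varnothing\ne S\subseteq\mathcal I}\frac{D(S)}{M(S)}.$$ Consequently, the following statements are equivalent: (1) there exists a stable Markovian dispatch policy; (2) there exists a stable state-independent randomized dispatch policy; (3) $\theta^*<1$; (4) $D(S)<M(S)$ for every nonempty $S\subseteq\mathcal I$.
   Context: System. $\mathcal I=\{1,\dots,I\}$ is a finite nonempty set of servers. $\mathcal E$ is a finite set of nonempty subsets of $\mathcal I$ (hyperedges), with $e\not\subseteq e'$ for distinct $e,e'\in\mathcal E$; each $e$ represents an overlapping service region whose calls may be served by any server in $e$. Each server $i$ also has a primary region whose calls can be served only by $i$. Calls arrive by independent Poisson processes with rates $\lambda_i\ge 0$ (primary region of $i$) and $\lambda_e\ge 0$ (overlapping region $e$). Server $i$ has exponential service times with rate $\mu_i>0$ and its own infinite-capacity queue. Dispatch policies and the Markov chain. States are vectors $B=(n_i)_{i\in\mathcal I}\in\mathbb Z_+^I$, where $n_i$ is the number of calls at server $i$ (in service plus waiting). States are enumerated as $B_u$, $u\in\mathcal U=\{0,1,2,\dots\}$, by a fixed bijection. A Markovian dispatch policy is a family $\eta=\{\eta_{e,u}: e\in\mathcal E,u\in\mathcal U\}$ where $\eta_{e,u}$ is a probability distribution on $\mathcal I$ supported on $e$; $\eta_{e,u}(i)$ is the probability that a call from region $e$ arriving in state $B_u$ is assigned to server $i$. The policy is state-independent if $\eta_{e,u}$ does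 not depend on $u$. Under $\eta$ the system is the continuous-time Markov chain (CTMC) on $\mathbb Z_+^I$ with transition rates (where $\mathbf e_i$ is the $i$-th unit vector): from $B_u$ to $B_u+\mathbf e_i$ at rate $\lambda_i+\sum_{e\in\mathcal E}\eta_{e,u}(i)\lambda_e$, and from $B_u$ to $B_u-\mathbf e_i$ at rate $\mu_i$ if $(B_u)_i>0$; no other transitions. The policy is stable if this CTMC is positive recurrent, in the sense that it admits a stationary probability distribution (unique, since the all-zero state is reachable from every state). Flows, demand, capacity. The hyperedge-flow polytope is $$\mathcal X:=\Big\{x=(x_{ei})_{e\in\mathcal E,\,i\in e}:\ x_{ei}\ge 0,\ \sum_{i\in e}x_{ei}=\lambda_e\ \ \forall e\in\mathcal E\Big\},$$ and for $x\in\mathcal X$, $a_i(x):=\lambda_i+\sum_{e\in\mathcal E:\,i\in e}x_{ei}$. For $S\subseteq\mathcal I$, $D(S):=\sum_{i\in S}\lambda_i+\sum_{e\in\mathcal E:\,e\subseteq S}\lambda_e$ and $M(S):=\sum_{i\in S}\mu_i$. *)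

theory Defs
  imports "HOL-Probability.Probability"
begin

section \<open>Continuous-time Markov chains with given transition rates\<close>

text \<open>
  \<open>P t x\<close> is the law at time \<open>t\<close> of the chain started in \<open>x\<close>; \<open>q x y\<close> is the transition rate
  from \<open>x\<close> to \<open>y\<close> for \<open>x \<noteq> y\<close> (the diagonal of \<open>q\<close> is never used). The \<open>P t x\<close> being probability
  distributions, the chain does not explode. For rates with bounded exit rates, as below, such a
  \<open>P\<close> exists and is unique on nonnegative times.
\<close>

definition ctmc_semigroup :: "('s \<Rightarrow> 's \<Rightarrow> real) \<Rightarrow> (real \<Rightarrow> 's \<Rightarrow> 's pmf) \<Rightarrow> bool" where
  "ctmc_semigroup q P \<longleftrightarrow>
     (\<forall>x. P 0 x = return_pmf x) \<and>
     (\<forall>s\<ge>0. \<forall>t\<ge>0. \<forall>x. P (s + t) x = bind_pmf (P s x) (P t)) \<and>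
     (\<forall>x y. x \<noteq> y \<longrightarrow> ((\<lambda>t. pmf (P t x) y / t) \<longlongrightarrow> q x y) (at_right 0)) \<and>
     (\<forall>x. ((\<lambda>t. (1 - pmf (P t x) x) / t) \<longlongrightarrow> (\<Sum>\<^sub>\<infinity>y\<in>-{x}. q x y)) (at_right 0))"

definition stationary_distribution :: "(real \<Rightarrow> 's \<Rightarrow> 's pmf) \<Rightarrow> 's pmf \<Rightarrow> bool" where
  "stationary_distribution P \<pi> \<longleftrightarrow> (\<forall>t\<ge>0. bind_pmf \<pi> (P t) = \<pi>)"

definition positive_recurrent :: "('s \<Rightarrow> 's \<Rightarrow> real) \<Rightarrow> bool" where
  "positive_recurrent q \<longleftrightarrow>
     (\<exists>P. ctmc_semigroup q P \<and> (\<exists>\<pi>. stationary_distribution P \<pi>))"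

section \<open>Dispatch policies\<close>

text \<open>
  Servers are the elements of a finite type, hyperedges a set \<open>E\<close> of sets of servers, and states
  are functions from servers to \<^typ>\<open>nat\<close>, enumerated by a bijection \<open>B\<close>. \<open>lam\<close> and \<open>lamE\<close> are the
  arrival rates of the primary and of the overlapping regions.
\<close>

definition dispatch_policy :: "'i set set \<Rightarrow> ('i set \<Rightarrow> nat \<Rightarrow> 'i pmf) \<Rightarrow> bool" where
  "dispatch_policy E \<eta> \<longleftrightarrow> (\<forall>e\<in>E. \<forall>u. set_pmf (\<eta> e u) \<subseteq> e)"

definition state_independent :: "'i set set \<Rightarrow> ('i set \<Rightarrow> nat \<Rightarrow> 'i pmf) \<Rightarrow> bool" where
  "state_independent E \<eta> \<longleftrightarrow> (\<forall>e\<in>E. \<forall>u v. \<eta> e u = \<eta> e v)"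

definition arrival_rate ::
  "'i set set \<Rightarrow> ('i \<Rightarrow> real) \<Rightarrow> ('i set \<Rightarrow> real) \<Rightarrow> ('i set \<Rightarrow> nat \<Rightarrow> 'i pmf) \<Rightarrow> nat \<Rightarrow> 'i \<Rightarrow> real" where
  "arrival_rate E lam lamE \<eta> u i = lam i + (\<Sum>e\<in>E. pmf (\<eta> e u) i * lamE e)"

text \<open>For given states \<open>n\<close> and \<open>n'\<close> at most one summand below is nonzero.\<close>

definition transition_rate ::
  "'i::finite set set \<Rightarrow> ('i \<Rightarrow> real) \<Rightarrow> ('i set \<Rightarrow> real) \<Rightarrow> ('i \<Rightarrow> real) \<Rightarrow> (nat \<Rightarrow> 'i \<Rightarrow> nat) \<Rightarrow>
   ('i set \<Rightarrow> nat \<Rightarrow> 'i pmf) \<Rightarrow> ('i \<Rightarrow> nat) \<Rightarrow> ('i \<Rightarrow> nat) \<Rightarrow> real" where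
  "transition_rate E lam lamE mu B \<eta> n n' =
     (\<Sum>i\<in>UNIV. if n' = n(i := n i + 1) then arrival_rate E lam lamE \<eta> (inv B n) i else 0) +
     (\<Sum>i\<in>UNIV. if n i > 0 \<and> n' = n(i := n i - 1) then mu i else 0)"

definition stable_policy ::
  "'i::finite set set \<Rightarrow> ('i \<Rightarrow> real) \<Rightarrow> ('i set \<Rightarrow> real) \<Rightarrow> ('i \<Rightarrow> real) \<Rightarrow> (nat \<Rightarrow> 'i \<Rightarrow> nat) \<Rightarrow>
   ('i set \<Rightarrow> nat \<Rightarrow> 'i pmf) \<Rightarrow> bool" where
  "stable_policy E lam lamE mu B \<eta> \<longleftrightarrow> positive_recurrent (transition_rate E lam lamE mu B \<eta>)"

section \<open>Flows, demand and capacity\<close>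

definition flow_polytope :: "'i set set \<Rightarrow> ('i set \<Rightarrow> real) \<Rightarrow> ('i set \<times> 'i \<Rightarrow> real) set" where
  "flow_polytope E lamE =
     {x \<in> (SIGMA e:E. e) \<rightarrow>\<^sub>E {0..}. \<forall>e\<in>E. (\<Sum>i\<in>e. x (e, i)) = lamE e}"

definition flow_load ::
  "'i set set \<Rightarrow> ('i \<Rightarrow> real) \<Rightarrow> ('i set \<times> 'i \<Rightarrow> real) \<Rightarrow> 'i \<Rightarrow> real" where
  "flow_load E lam x i = lam i + (\<Sum>e\<in>{e\<in>E. i \<in> e}. x (e, i))"

definition peak_workload ::
  "'i::finite set set \<Rightarrow> ('i \<Rightarrow> real) \<Rightarrow> ('i \<Rightarrow> real) \<Rightarrow> ('i set \<times> 'i \<Rightarrow> real) \<Rightarrow> real" where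
  "peak_workload E lam mu x = (MAX i. flow_load E lam x i / mu i)"

text \<open>
  An infimum of reals need not be attained, so a statement about \<open>min_peak_workload\<close> as a
  minimum has to assert attainment.
\<close>

definition min_peak_workload ::
  "'i::finite set set \<Rightarrow> ('i \<Rightarrow> real) \<Rightarrow> ('i set \<Rightarrow> real) \<Rightarrow> ('i \<Rightarrow> real) \<Rightarrow> real" where
  "min_peak_workload E lam lamE mu = (INF x\<in>flow_polytope E lamE. peak_workload E lam mu x)"

definition demand :: "'i set set \<Rightarrow> ('i \<Rightarrow> real) \<Rightarrow> ('i set \<Rightarrow> real) \<Rightarrow> 'i set \<Rightarrow> real" where
  "demand E lam lamE S = (\<Sum>i\<in>S. lam i) + (\<Sum>e\<in>{e\<in>E. e \<subseteq> S}. lamE e)"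

definition capacity :: "('i \<Rightarrow> real) \<Rightarrow> 'i set \<Rightarrow> real" where
  "capacity mu S = (\<Sum>i\<in>S. mu i)"

end

theory Submission
  imports Defs
begin

text \<open>
  The inequality \<open>\<ge>\<close> of the duality holds because the servers of \<open>S\<close> have to carry all flow of
  hyperedges inside \<open>S\<close>. For \<open>\<le>\<close>, a flow with loads at most \<open>c * mu\<close> is found greedily whenever
  \<open>demand S \<le> c * capacity S\<close> for all \<open>S\<close>, by a submodularity argument.

  If \<open>\<theta> < 1\<close>, splitting the overlapping regions according to an optimal flow makes the servers
  independent M/M/1 queues. The semigroup of this chain is a Poisson mixture of powers of a jump
  kernel (uniformization), and the product of geometric distributions is reversible for it.

  Conversely, let \<open>\<pi>\<close> be stationary for some policy and \<open>r m\<close> the probability under \<open>\<pi>\<close> that \<open>m\<close>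
  calls are at the servers of \<open>S\<close>. Balancing the flow across the cut between the levels \<open>m\<close> and
  \<open>m + 1\<close> gives \<open>demand S * r m \<le> capacity S * r (m + 1)\<close>. If \<open>demand S \<ge> capacity S\<close>, then \<open>r\<close>
  is nondecreasing, which is impossible for a probability distribution on the naturals.
\<close>

section \<open>Min-max duality for hyperedge flows\<close>

text \<open>The component \<open>d\<close> at \<open>i\<close> is chosen as large as the constraints allow; submodularity, applied
  to \<open>S\<close> and a tight set \<open>T\<close>, shows that the rest of \<open>e\<close> can absorb \<open>w - d\<close>.\<close>

lemma submodular_split:
  fixes g :: "'i::finite set \<Rightarrow> real"
  assumes "finite e" "e \<noteq> {}"
    and "\<And>S T. g (S \<union> T) + g (S \<inter> T) \<le> g S + g T"
    and "\<And>S. 0 \<le> g S" and "\<And>S. e \<subseteq> S \<Longrightarrow> w \<le> g S" and "0 \<le> w"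
  shows "\<exists>y. (\<forall>i. 0 \<le> y i) \<and> (\<forall>i. i \<notin> e \<longrightarrow> y i = 0) \<and> sum y e = w \<and> (\<forall>S. sum y S \<le> g S)"
  using assms
proof (induction e arbitrary: g w rule: finite_ne_induct)
  case (singleton i)
  have "(\<Sum>j\<in>S. if j = i then w else 0) \<le> g S" for S
    using singleton.prems(2,3) by auto
  then show ?case
    using singleton.prems(4) by (intro exI[of _ "\<lambda>j. if j = i then w else 0"]) auto
next
  case (insert i e)
  define m where "m = Min (g ` {T. i \<in> T})"
  define d where "d = min w m"
  have ne: "{T. i \<in> T} \<noteq> {}" by auto
  have m_le: "m \<le> g T" if "i \<in> T" for T
    unfolding m_def using that by (intro Min_le) auto
  have "m \<in> g ` {T. i \<in> T}"
    unfolding m_def by (rule Min_in) (use ne in auto)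
  then obtain T where T: "i \<in> T" "m = g T" by auto
  have d: "0 \<le> d" "d \<le> w" "d \<le> m"
    using insert.prems(2,4) T by (auto simp: d_def)
  define g' where "g' S = g S - (if i \<in> S then d else 0)" for S
  have 1: "g' (S \<union> U) + g' (S \<inter> U) \<le> g' S + g' U" for S U
    using insert.prems(1)[of S U] by (auto simp: g'_def)
  have 2: "0 \<le> g' S" for S
    using insert.prems(2)[of S] m_le[of S] d by (auto simp: g'_def)
  have 3: "w - d \<le> g' S" if "e \<subseteq> S" for S
  proof (cases "i \<in> S")
    case True
    then show ?thesis using insert.prems(3)[of S] that by (auto simp: g'_def)
  next
    case False
    \<comment> \<open>\<open>T\<close> supplies \<open>i\<close> and \<open>S\<close> the rest of
      the hyperedge, so the bound for supersets applies to the union. This serves the case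
      \<open>d = m\<close>; if \<open>d = w\<close>, nothing remains to be placed.\<close>
    have "w \<le> g (S \<union> T)" using insert.prems(3) that T by auto
    then have "w \<le> g S + m"
      using insert.prems(1)[of S T] insert.prems(2)[of "S \<inter> T"] T by auto
    then show ?thesis
      using False insert.prems(2)[of S] by (auto simp: g'_def d_def)
  qed
  obtain y where y: "\<And>j. 0 \<le> y j" "\<And>j. j \<notin> e \<Longrightarrow> y j = 0" "sum y e = w - d" "\<And>S. sum y S \<le> g' S"
    using insert.IH[of g' "w - d"] 1 2 3 d by auto
  define z where "z = (\<lambda>j. y j + (if j = i then d else 0))"
  have z: "sum z S = sum y S + (if i \<in> S then d else 0)" for S
    by (simp add: z_def sum.distrib)
  show ?case
  proof (intro exI conjI allI impI)
    show "0 \<le> z j" for j using y d by (auto simp: z_def)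
    show "z j = 0" if "j \<notin> insert i e" for j using y that by (auto simp: z_def)
    show "sum z (insert i e) = w"
      using z[of "insert i e"] insert.hyps y by simp
    show "sum z S \<le> g S" for S
      using z[of S] y(4)[of S] by (auto simp: g'_def split: if_splits)
  qed
qed

text \<open>Checked for each hyperedge: one lying in both sets lies in their union and in their
  intersection, one lying in a single set still lies in the union.\<close>

lemma sum_subsets_supermodular:
  fixes w :: "'i set \<Rightarrow> real"
  assumes "finite F" and "\<And>e. e \<in> F \<Longrightarrow> 0 \<le> w e"
  shows "(\<Sum>e\<in>{e\<in>F. e \<subseteq> S}. w e) + (\<Sum>e\<in>{e\<in>F. e \<subseteq> T}. w e)
    \<le> (\<Sum>e\<in>{e\<in>F. e \<subseteq> S \<union> T}. w e) + (\<Sum>e\<in>{e\<in>F. e \<subseteq> S \<inter> T}. w e)"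
proof -
  have eq: "(\<Sum>e\<in>{e\<in>F. e \<subseteq> S}. w e) = (\<Sum>e\<in>F. if e \<subseteq> S then w e else 0)" for S
    using assms(1) by (simp add: sum.inter_filter)
  show ?thesis
    unfolding eq sum.distrib[symmetric] using assms(2) by (intro sum_mono) auto
qed

text \<open>Induction on \<open>F\<close>: one hyperedge at a time is routed within the slack \<open>g\<close>, which is submodular
  because the demand is supermodular.\<close>

lemma hypergraph_flow:
  fixes w :: "'i::finite set \<Rightarrow> real" and b :: "'i \<Rightarrow> real"
  assumes "finite F" and "\<And>e. e \<in> F \<Longrightarrow> e \<noteq> {}" and "\<And>e. e \<in> F \<Longrightarrow> 0 \<le> w e"
    and "\<And>S. (\<Sum>e\<in>{e\<in>F. e \<subseteq> S}. w e) \<le> sum b S"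
  shows "\<exists>x. (\<forall>e\<in>F. (\<forall>i. 0 \<le> x e i) \<and> (\<forall>i. i \<notin> e \<longrightarrow> x e i = 0) \<and> sum (x e) e = w e) \<and>
    (\<forall>i. (\<Sum>e\<in>F. x e i) \<le> b i)"
  using assms
proof (induction F arbitrary: b rule: finite_induct)
  case empty
  have "0 \<le> b i" for i using empty.prems(3)[of "{i}"] by simp
  then show ?case by auto
next
  case (insert e F)
  define h where "h S = (\<Sum>e\<in>{e\<in>F. e \<subseteq> S}. w e)" for S
  define g where "g S = sum b S - h S" for S
  have h_insert: "(\<Sum>e\<in>{e'\<in>insert e F. e' \<subseteq> S}. w e) = h S + (if e \<subseteq> S then w e else 0)" for S
  proof -
    have "{e'\<in>insert e F. e' \<subseteq> S} = (if e \<subseteq> S then insert e {e'\<in>F. e' \<subseteq> S} else {e'\<in>F. e' \<subseteq> S})"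
      by auto
    then show ?thesis using insert.hyps by (auto simp: h_def)
  qed
  have "g (S \<union> T) + g (S \<inter> T) \<le> g S + g T" for S T
    using sum_subsets_supermodular[of F w S T] insert.hyps insert.prems(2)
      sum.union_inter[of S T b]
    by (auto simp: g_def h_def)
  moreover have "0 \<le> g S" for S
    using insert.prems(3)[of S] h_insert[of S] insert.prems(2)[of e]
    by (auto simp: g_def split: if_splits)
  moreover have "w e \<le> g S" if "e \<subseteq> S" for S
    using insert.prems(3)[of S] h_insert[of S] that by (auto simp: g_def)
  ultimately obtain y where y: "\<And>i. 0 \<le> y i" "\<And>i. i \<notin> e \<Longrightarrow> y i = 0" "sum y e = w e"
    "\<And>S. sum y S \<le> g S"
    using submodular_split[of e g "w e"] insert.prems(1,2) by auto
  \<comment> \<open>Staying within the slack is exactly the hypothesis of the induction for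
    \<open>F\<close> with the capacities reduced by \<open>y\<close>.\<close>
  have "h S \<le> (\<Sum>i\<in>S. b i - y i)" for S
    using y(4)[of S] by (simp add: g_def sum_subtractf)
  then have "\<exists>x. (\<forall>e\<in>F. (\<forall>i. 0 \<le> x e i) \<and> (\<forall>i. i \<notin> e \<longrightarrow> x e i = 0) \<and> sum (x e) e = w e) \<and>
    (\<forall>i. (\<Sum>e\<in>F. x e i) \<le> b i - y i)"
    using insert.prems(1,2) by (intro insert.IH) (auto simp: h_def)
  then obtain x where x: "\<And>e i. e \<in> F \<Longrightarrow> 0 \<le> x e i" "\<And>e i. e \<in> F \<Longrightarrow> i \<notin> e \<Longrightarrow> x e i = 0"
    "\<And>e. e \<in> F \<Longrightarrow> sum (x e) e = w e" "\<And>i. (\<Sum>e\<in>F. x e i) \<le> b i - y i"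
    by metis
  have "(\<Sum>e'\<in>insert e F. (x(e := y)) e' i) \<le> b i" for i
  proof -
    have "(\<Sum>e'\<in>F. (x(e := y)) e' i) = (\<Sum>e'\<in>F. x e' i)"
      using insert.hyps by (intro sum.cong) auto
    then show ?thesis using insert.hyps x(4)[of i] by simp
  qed
  then show ?case
    using x y by (intro exI[of _ "x(e := y)"]) (simp add: fun_upd_def)
qed

section \<open>Duality between flows and demand ratios\<close>

lemma demand_le_flow_load:
  fixes E :: "'i::finite set set"
  assumes "x \<in> flow_polytope E lamE"
  shows "demand E lam lamE S \<le> (\<Sum>i\<in>S. flow_load E lam x i)"
proof -
  have pos: "0 \<le> x (e, i)" if "e \<in> E" "i \<in> e" for e i
    using assms that by (auto simp: flow_polytope_def PiE_iff)
  \<comment> \<open>For \<open>e\<close> inside \<open>S\<close> the intersection is all of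
    \<open>e\<close>. In this form the summand makes sense for every hyperedge, so the sum can be
    enlarged to all of \<open>E\<close>.\<close>
  have "(\<Sum>e\<in>{e\<in>E. e \<subseteq> S}. lamE e) = (\<Sum>e\<in>{e\<in>E. e \<subseteq> S}. \<Sum>i\<in>S \<inter> e. x (e, i))"
    using assms by (intro sum.cong refl) (auto simp: flow_polytope_def Int_absorb1)
  also have "\<dots> \<le> (\<Sum>e\<in>E. \<Sum>i\<in>S \<inter> e. x (e, i))"
    using pos by (intro sum_mono2) (auto intro!: sum_nonneg)
  also have "\<dots> = (\<Sum>e\<in>E. \<Sum>i\<in>S. if i \<in> e then x (e, i) else 0)"
    by (simp add: sum.inter_restrict)
  also have "\<dots> = (\<Sum>i\<in>S. \<Sum>e\<in>{e\<in>E. i \<in> e}. x (e, i))"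
    by (subst sum.swap) (simp add: sum.inter_filter)
  finally show ?thesis
    by (simp add: demand_def flow_load_def sum.distrib)
qed

lemma capacity_pos:
  fixes mu :: "'i::finite \<Rightarrow> real"
  assumes "\<And>i. 0 < mu i" "S \<noteq> {}"
  shows "0 < capacity mu S"
  unfolding capacity_def using assms by (intro sum_pos) auto

text \<open>Weak duality: total load over total capacity is the \<open>mu\<close>-weighted average
  of the workloads of single servers, hence at most their maximum.\<close>

lemma demand_capacity_le_peak:
  fixes E :: "'i::finite set set"
  assumes "\<And>i. 0 < mu i" "S \<noteq> {}" and "x \<in> flow_polytope E lamE"
  shows "demand E lam lamE S / capacity mu S \<le> peak_workload E lam mu x"
proof -
  have "flow_load E lam x i / mu i \<le> peak_workload E lam mu x" for i
    unfolding peak_workload_def by (rule Max_ge) auto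
  then have "flow_load E lam x i \<le> peak_workload E lam mu x * mu i" for i
    using assms(1) by (simp add: pos_divide_le_eq)
  then have "(\<Sum>i\<in>S. flow_load E lam x i) \<le> peak_workload E lam mu x * capacity mu S"
    unfolding capacity_def sum_distrib_left by (intro sum_mono) auto
  then show ?thesis
    using demand_le_flow_load[OF assms(3), of lam S] capacity_pos[of mu S] assms
    by (auto simp: pos_divide_le_eq)
qed

text \<open>\<open>c * mu i - lam i\<close> is what server \<open>i\<close> has left for overlapping
  calls. The demand bounds say that these remainders satisfy the condition of
  \<open>hypergraph_flow\<close>.\<close>

lemma flow_with_peak_le:
  fixes E :: "'i::finite set set"
  assumes "\<And>e. e \<in> E \<Longrightarrow> e \<noteq> {}" and "\<And>e. e \<in> E \<Longrightarrow> lamE e \<ge> 0" and "\<And>i. mu i > 0"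
    and "\<And>S. S \<noteq> {} \<Longrightarrow> demand E lam lamE S \<le> c * capacity mu S"
  shows "\<exists>x\<in>flow_polytope E lamE. peak_workload E lam mu x \<le> c"
proof -
  have "(\<Sum>e\<in>{e\<in>E. e \<subseteq> S}. lamE e) \<le> (\<Sum>i\<in>S. c * mu i - lam i)" for S
  proof (cases "S = {}")
    case True
    then have "{e\<in>E. e \<subseteq> S} = {}" using assms(1) by auto
    then show ?thesis using True by (simp only: sum.empty)
  next
    case False
    then show ?thesis using assms(4)[of S]
      by (simp add: demand_def capacity_def sum_subtractf sum_distrib_left)
  qed
  then obtain x where x: "\<And>e i. e \<in> E \<Longrightarrow> 0 \<le> x e i" "\<And>e i. e \<in> E \<Longrightarrow> i \<notin> e \<Longrightarrow> x e i = 0"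
    "\<And>e. e \<in> E \<Longrightarrow> sum (x e) e = lamE e" "\<And>i. (\<Sum>e\<in>E. x e i) \<le> c * mu i - lam i"
    using hypergraph_flow[of E lamE "\<lambda>i. c * mu i - lam i"] assms(1,2) by (auto, metis)
  \<comment> \<open>Members of \<open>flow_polytope\<close> are extensional, so the values at pairs
    with \<open>i\<close> outside \<open>e\<close> or \<open>e\<close> outside \<open>E\<close> are
    cut off.\<close>
  define z where "z = restrict (\<lambda>(e, i). x e i) (SIGMA e:E. e)"
  have "z \<in> flow_polytope E lamE"
    using x by (auto simp: flow_polytope_def z_def)
  moreover have "peak_workload E lam mu z \<le> c"
    unfolding peak_workload_def
  proof (subst Max_le_iff, simp, simp, safe)
    fix i
    have "(\<Sum>e\<in>{e\<in>E. i \<in> e}. z (e, i)) = (\<Sum>e\<in>{e\<in>E. i \<in> e}. x e i)"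
      by (intro sum.cong) (auto simp: z_def)
    also have "\<dots> \<le> (\<Sum>e\<in>E. x e i)"
      using x by (intro sum_mono2) auto
    finally have "flow_load E lam z i \<le> c * mu i"
      using x(4)[of i] by (simp add: flow_load_def)
    then show "flow_load E lam z i / mu i \<le> c"
      using assms(3) by (simp add: pos_divide_le_eq)
  qed
  ultimately show ?thesis by blast
qed

text \<open>With \<open>c\<close> the largest demand ratio, the flow from
  \<open>flow_with_peak_le\<close> meets the lower bound of weak duality. This single witness turns
  the infimum into a minimum and identifies its value.\<close>

lemma min_peak_workload_eq:
  fixes E :: "'i::finite set set"
  assumes "\<And>e. e \<in> E \<Longrightarrow> e \<noteq> {}" and "\<And>e. e \<in> E \<Longrightarrow> lamE e \<ge> 0" and "\<And>i. mu i > 0"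
  shows "min_peak_workload E lam lamE mu = (MAX S\<in>{S. S \<noteq> {}}. demand E lam lamE S / capacity mu S)"
      (is "_ = ?m")
    and "\<exists>x\<in>flow_polytope E lamE. peak_workload E lam mu x = min_peak_workload E lam lamE mu"
    and "x \<in> flow_polytope E lamE \<Longrightarrow> min_peak_workload E lam lamE mu \<le> peak_workload E lam mu x"
proof -
  have ne: "{S. S \<noteq> {}} \<noteq> ({} :: 'i set set)" by blast
  have lower: "?m \<le> peak_workload E lam mu x" if "x \<in> flow_polytope E lamE" for x
    using ne demand_capacity_le_peak[OF assms(3) _ that] by (subst Max_le_iff) auto
  have "demand E lam lamE S \<le> ?m * capacity mu S" if "S \<noteq> {}" for S
  proof -
    have "demand E lam lamE S / capacity mu S \<le> ?m"
      using that by (intro Max_ge) auto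
    then show ?thesis
      by (rule iffD1[OF pos_divide_le_eq[OF capacity_pos[OF assms(3) that]]])
  qed
  then have "\<exists>x\<in>flow_polytope E lamE. peak_workload E lam mu x \<le> ?m"
    using assms by (intro flow_with_peak_le)
  then obtain x where x: "x \<in> flow_polytope E lamE" "peak_workload E lam mu x \<le> ?m" ..
  have px: "peak_workload E lam mu x = ?m"
    using x lower by (intro antisym) auto
  show eq: "min_peak_workload E lam lamE mu = ?m"
    unfolding min_peak_workload_def
    by (rule cInf_eq_minimum) (use x px lower in \<open>auto intro!: rev_image_eqI\<close>)
  show "\<exists>x\<in>flow_polytope E lamE. peak_workload E lam mu x = min_peak_workload E lam lamE mu"
    using x px eq by auto
  show "x \<in> flow_polytope E lamE \<Longrightarrow> min_peak_workload E lam lamE mu \<le> peak_workload E lam mu x" for x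
    using lower eq by simp
qed

section \<open>Flow across a cut under a stationary distribution\<close>

text \<open>Testing membership in \<open>A\<close> turns the claim into the formula for the mass of
  a bind at the point \<open>True\<close>.\<close>

lemma measure_bind_pmf_eq: "measure (bind_pmf M f) A = (\<integral>x. measure (f x) A \<partial>measure_pmf M)"
proof -
  have eq: "measure (measure_pmf p) A = pmf (map_pmf (\<lambda>x. x \<in> A) p) True" for p
    by (simp add: pmf_map vimage_def)
  show ?thesis by (simp only: eq map_bind_pmf pmf_bind)
qed

text \<open>By Bernoulli's inequality \<open>p t \<ge> p (t / n) ^ n \<ge> 1 - n * (1 - p (t / n))\<close> for the holding
  probability \<open>p\<close>; let \<open>n\<close> tend to infinity. This linear bound is what dominates the difference
  quotients in the cut balance below.\<close>

lemma ctmc_leave_prob_le: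
  assumes "ctmc_semigroup q P" "0 < t"
  shows "1 - pmf (P t x) x \<le> t * (\<Sum>\<^sub>\<infinity>y\<in>-{x}. q x y)"
proof -
  define p where "p s = pmf (P s x) x" for s
  have p0: "p 0 = 1"
    using assms by (auto simp: ctmc_semigroup_def p_def)
  have super: "p r * p s \<le> p (r + s)" if "0 \<le> r" "0 \<le> s" for r s
  proof -
    have "p r * p s = (\<integral>z. indicator {x} z * p s \<partial>P r x)"
      by (simp add: p_def pmf.rep_eq)
    also have "\<dots> \<le> (\<integral>z. pmf (P s z) x \<partial>P r x)"
      by (intro integral_mono measure_pmf.integrable_const_bound[where B=1] AE_I2)
        (auto simp: p_def indicator_def pmf_le_1)
    also have "\<dots> = p (r + s)"
      using assms(1) that by (simp add: ctmc_semigroup_def p_def pmf_bind)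
    finally show ?thesis .
  qed
  have pow: "p s ^ n \<le> p (real n * s)" if "0 \<le> s" for s n
  proof (induction n)
    case (Suc n)
    have "p s ^ Suc n \<le> p s * p (real n * s)"
      using Suc by (simp add: mult_left_mono p_def)
    also have "\<dots> \<le> p (real (Suc n) * s)"
      using super[of s "real n * s"] that by (simp add: algebra_simps)
    finally show ?case .
  qed (simp add: p0)
  have bound: "1 - p t \<le> t * ((1 - p (t / real (Suc n))) / (t / real (Suc n)))" for n
  proof -
    let ?s = "t / real (Suc n)"
    have "1 + real (Suc n) * (p ?s - 1) \<le> (1 + (p ?s - 1)) ^ Suc n"
      by (rule Bernoulli_inequality) (simp add: p_def)
    also have "\<dots> \<le> p t" using pow[of ?s "Suc n"] assms(2) by simp
    finally have "1 - p t \<le> real (Suc n) * (1 - p ?s)" by (simp only: algebra_simps)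
    also have "\<dots> = t * ((1 - p ?s) / ?s)" using assms(2) by (simp add: field_simps del: of_nat_Suc)
    finally show ?thesis .
  qed
  have "filterlim (\<lambda>n. t / real (Suc n)) (at_right 0) sequentially"
  proof (rule tendsto_imp_filterlim_at_right)
    show "(\<lambda>n. t / real (Suc n)) \<longlonglongrightarrow> 0"
      by (rule LIMSEQ_Suc[OF lim_const_over_n])
  qed (use assms(2) in auto)
  moreover have "((\<lambda>s. (1 - p s) / s) \<longlongrightarrow> (\<Sum>\<^sub>\<infinity>y\<in>-{x}. q x y)) (at_right 0)"
    using assms(1) by (auto simp: ctmc_semigroup_def p_def)
  ultimately have "(\<lambda>n. (1 - p (t / real (Suc n))) / (t / real (Suc n)))
      \<longlonglongrightarrow> (\<Sum>\<^sub>\<infinity>y\<in>-{x}. q x y)"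
    by (rule filterlim_compose[rotated])
  then have "(\<lambda>n. t * ((1 - p (t / real (Suc n))) / (t / real (Suc n))))
      \<longlonglongrightarrow> t * (\<Sum>\<^sub>\<infinity>y\<in>-{x}. q x y)"
    by (rule tendsto_mult_left)
  then show ?thesis
    unfolding p_def[symmetric] by (rule LIMSEQ_le_const) (use bound in auto)
qed

text \<open>\<open>A\<close> may be infinite. The mass outside \<open>F\<close> is negligible because the total exit rate is
  already exhausted by the rates into \<open>F\<close>.\<close>

lemma ctmc_rate_into_set:
  assumes "ctmc_semigroup q P" "finite F" "x \<notin> F" "\<And>y. y \<notin> F \<Longrightarrow> y \<noteq> x \<Longrightarrow> q x y = 0" "x \<notin> A"
  shows "((\<lambda>t. measure (P t x) A / t) \<longlongrightarrow> (\<Sum>y\<in>F \<inter> A. q x y)) (at_right 0)"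
proof -
  have lim: "((\<lambda>t. pmf (P t x) y / t) \<longlongrightarrow> q x y) (at_right 0)" if "y \<in> F" for y
  proof -
    have "x \<noteq> y" using assms(3) that by auto
    then show ?thesis using assms(1) by (simp add: ctmc_semigroup_def)
  qed
  have "(\<Sum>\<^sub>\<infinity>y\<in>-{x}. q x y) = (\<Sum>\<^sub>\<infinity>y\<in>F. q x y)"
    using assms(3,4) by (intro infsum_cong_neutral) auto
  then have total: "(\<Sum>\<^sub>\<infinity>y\<in>-{x}. q x y) = (\<Sum>y\<in>F. q x y)"
    using assms(2) by simp
  have sum_pmf: "(\<lambda>t. measure (P t x) (F \<inter> C) / t) = (\<lambda>t. \<Sum>y\<in>F \<inter> C. pmf (P t x) y / t)" for C
    using assms(2) by (simp add: measure_measure_pmf_finite sum_divide_distrib)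
  have part: "((\<lambda>t. measure (P t x) (F \<inter> C) / t) \<longlongrightarrow> (\<Sum>y\<in>F \<inter> C. q x y)) (at_right 0)" for C
    unfolding sum_pmf by (intro tendsto_sum lim) auto
  have "((\<lambda>t. (1 - pmf (P t x) x) / t - measure (P t x) (F \<inter> UNIV) / t) \<longlongrightarrow>
      (\<Sum>y\<in>F. q x y) - (\<Sum>y\<in>F \<inter> UNIV. q x y)) (at_right 0)"
    using assms(1) by (intro tendsto_diff part) (auto simp: ctmc_semigroup_def total[symmetric])
  then have rest: "((\<lambda>t. (1 - pmf (P t x) x) / t - measure (P t x) F / t) \<longlongrightarrow> 0) (at_right 0)"
    by simp
  have split: "measure (P t x) A = measure (P t x) (F \<inter> A) + measure (P t x) (A - F)" for t
    using measure_pmf.finite_measure_Diff'[of A "P t x" F] by (simp add: Int_commute)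
  have tail: "measure (P t x) (A - F) \<le> 1 - pmf (P t x) x - measure (P t x) F" for t
  proof -
    have "measure (P t x) ({x} \<union> F) = measure (P t x) {x} + measure (P t x) F"
      using assms(3) by (intro measure_pmf.finite_measure_Union) auto
    then have "measure (P t x) (A - F) + (measure (P t x) {x} + measure (P t x) F)
        = measure (P t x) ((A - F) \<union> ({x} \<union> F))"
      using assms(3,5) by (subst measure_pmf.finite_measure_Union) auto
    also have "\<dots> \<le> 1" by (rule measure_pmf.prob_le_1)
    finally show ?thesis by (simp add: measure_pmf_single)
  qed
  have "((\<lambda>t. measure (P t x) (A - F) / t) \<longlongrightarrow> 0) (at_right 0)"
  proof (rule tendsto_sandwich[OF _ _ tendsto_const rest])
    show "\<forall>\<^sub>F t in at_right 0. 0 \<le> measure (P t x) (A - F) / t"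
      using eventually_at_right_less by (rule eventually_mono) auto
    show "\<forall>\<^sub>F t in at_right 0. measure (P t x) (A - F) / t
        \<le> (1 - pmf (P t x) x) / t - measure (P t x) F / t"
      using eventually_at_right_less
    proof (rule eventually_mono)
      show "measure (P t x) (A - F) / t \<le> (1 - pmf (P t x) x) / t - measure (P t x) F / t"
        if "0 < t" for t
        using divide_right_mono[OF tail[of t], of t] that by (simp add: diff_divide_distrib)
    qed
  qed
  from tendsto_add[OF part[of A] this] show ?thesis
    by (simp add: split add_divide_distrib)
qed

text \<open>Stationarity equates the mass leaving \<open>A\<close> with the mass entering it during
  time \<open>t n\<close>. Dividing by \<open>t n\<close> and letting it tend to 0 turns both into
  rates; the uniform bound \<open>L\<close> on the exit rates lets the limit pass under the
  integral.\<close>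

lemma stationary_cut_balance:
  assumes "ctmc_semigroup q P" "stationary_distribution P \<pi>"
    and "\<And>x. finite (F x)" "\<And>x. x \<notin> F x" "\<And>x y. y \<notin> F x \<Longrightarrow> y \<noteq> x \<Longrightarrow> q x y = 0"
    and "\<And>x. (\<Sum>y\<in>F x. q x y) \<le> L"
  shows "(\<integral>x. indicator A x * (\<Sum>y\<in>F x - A. q x y) \<partial>measure_pmf \<pi>)
       = (\<integral>x. indicator (-A) x * (\<Sum>y\<in>F x \<inter> A. q x y) \<partial>measure_pmf \<pi>)"
proof -
  \<comment> \<open>Dominated convergence is applied to a sequence, hence discrete times decreasing
    to 0.\<close>
  define t where "t n = 1 / real (Suc n)" for n
  have t_pos: "0 < t n" for n by (simp add: t_def)
  have t_lim: "filterlim t (at_right 0) sequentially"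
  proof (rule tendsto_imp_filterlim_at_right)
    show "t \<longlonglongrightarrow> 0"
      unfolding t_def by (rule LIMSEQ_Suc[OF lim_const_over_n])
  qed (use t_pos in auto)
  have total: "(\<Sum>\<^sub>\<infinity>y\<in>-{x}. q x y) = (\<Sum>y\<in>F x. q x y)" for x
  proof -
    have "(\<Sum>\<^sub>\<infinity>y\<in>-{x}. q x y) = (\<Sum>\<^sub>\<infinity>y\<in>F x. q x y)"
      using assms(4,5) by (intro infsum_cong_neutral) auto
    then show ?thesis using assms(3) by simp
  qed
  have bound: "measure (P (t n) x) C / t n \<le> L" if "x \<notin> C" for n x C
  proof -
    have "measure (P (t n) x) C \<le> measure (P (t n) x) (- {x})"
      using that by (intro measure_pmf.finite_measure_mono) auto
    also have "\<dots> = 1 - pmf (P (t n) x) x"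
      using measure_pmf.prob_compl[of "{x}" "P (t n) x"] by (simp add: Compl_eq_Diff_UNIV measure_pmf_single)
    also have "\<dots> \<le> t n * (\<Sum>y\<in>F x. q x y)"
      using ctmc_leave_prob_le[OF assms(1) t_pos] by (simp add: total)
    also have "\<dots> \<le> t n * L"
      using assms(6) t_pos[of n] by (intro mult_left_mono) auto
    finally show ?thesis using t_pos[of n] by (simp add: pos_divide_le_eq mult.commute)
  qed
  have conv: "(\<lambda>n. \<integral>x. indicator (-C) x * (measure (P (t n) x) C / t n) \<partial>measure_pmf \<pi>)
      \<longlonglongrightarrow> (\<integral>x. indicator (-C) x * (\<Sum>y\<in>F x \<inter> C. q x y) \<partial>measure_pmf \<pi>)" for C
  proof (rule integral_dominated_convergence[where w = "\<lambda>_. L"])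
    have "(\<lambda>n. measure (P (t n) x) C / t n) \<longlonglongrightarrow> (\<Sum>y\<in>F x \<inter> C. q x y)" if "x \<notin> C" for x
      using ctmc_rate_into_set[OF assms(1,3,4,5) that] t_lim by (rule filterlim_compose)
    then show "AE x in measure_pmf \<pi>. (\<lambda>n. indicator (-C) x * (measure (P (t n) x) C / t n))
        \<longlonglongrightarrow> indicator (-C) x * (\<Sum>y\<in>F x \<inter> C. q x y)"
      by (auto simp: indicator_def intro!: AE_I2)
    \<comment> \<open>On \<open>C\<close> the integrand vanishes, and domination by \<open>L\<close>
      there means that \<open>L\<close> is nonnegative.\<close>
    have "0 \<le> L"
    proof -
      have "0 \<le> measure (P (t 0) undefined) {} / t 0" by simp
      then show ?thesis using bound[of undefined "{}" 0] by simp
    qed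
    then show "AE x in measure_pmf \<pi>. norm (indicator (-C) x * (measure (P (t n) x) C / t n)) \<le> L" for n
      using bound[of _ C n] t_pos[of n] by (intro AE_I2) (auto simp: indicator_def abs_of_pos)
  qed auto
  have swap: "(\<integral>x. indicator (-A) x * (measure (P (t n) x) A / t n) \<partial>measure_pmf \<pi>)
      = (\<integral>x. indicator A x * (measure (P (t n) x) (-A) / t n) \<partial>measure_pmf \<pi>)" for n
  proof -
    have int: "integrable (measure_pmf \<pi>) (\<lambda>x. indicator C x * measure (P (t n) x) D)" for C D
      by (intro measure_pmf.integrable_const_bound[where B=1] AE_I2) (auto simp: indicator_def)
    have compl: "measure (P (t n) x) (-A) = 1 - measure (P (t n) x) A" for x
      using measure_pmf.prob_compl[of A "P (t n) x"] by (simp add: Compl_eq_Diff_UNIV)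
    \<comment> \<open>The mass of \<open>A\<close> after time \<open>t n\<close> is what stayed plus
      what entered; further down, the mass before it is what stayed plus what leaves.\<close>
    have "measure \<pi> A = measure (bind_pmf \<pi> (P (t n))) A"
      using assms(2) t_pos[of n] by (simp add: stationary_distribution_def)
    also have "\<dots> = (\<integral>x. indicator A x * measure (P (t n) x) A + indicator (-A) x * measure (P (t n) x) A \<partial>measure_pmf \<pi>)"
      unfolding measure_bind_pmf_eq by (intro Bochner_Integration.integral_cong) (auto simp: indicator_def)
    also have "\<dots> = (\<integral>x. indicator A x * measure (P (t n) x) A \<partial>measure_pmf \<pi>)
        + (\<integral>x. indicator (-A) x * measure (P (t n) x) A \<partial>measure_pmf \<pi>)"
      by (intro Bochner_Integration.integral_add int)
    finally have 1: "measure \<pi> A = \<dots>" .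
    have "(\<integral>x. indicator A x * measure (P (t n) x) (-A) \<partial>measure_pmf \<pi>)
        = (\<integral>x. indicator A x - indicator A x * measure (P (t n) x) A \<partial>measure_pmf \<pi>)"
      by (simp add: compl algebra_simps)
    also have "\<dots> = measure \<pi> A - (\<integral>x. indicator A x * measure (P (t n) x) A \<partial>measure_pmf \<pi>)"
      by (subst Bochner_Integration.integral_diff[OF _ int])
        (auto intro!: measure_pmf.integrable_const_bound[where B=1] simp: indicator_def)
    finally show ?thesis using 1 by simp
  qed
  have lim: "(\<lambda>n. \<integral>x. indicator A x * (measure (P (t n) x) (-A) / t n) \<partial>measure_pmf \<pi>)
      \<longlonglongrightarrow> (\<integral>x. indicator A x * (\<Sum>y\<in>F x - A. q x y) \<partial>measure_pmf \<pi>)"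
    using conv[of "-A"] by (simp only: double_complement Diff_eq)
  show ?thesis
    by (rule LIMSEQ_unique[OF lim conv[of A, unfolded swap]])
qed

section \<open>Level crossings of the queueing network\<close>

text \<open>Departures are restricted to busy servers, since truncated subtraction at an empty one
  would make \<open>n\<close> its own neighbour.\<close>

definition neighbours :: "('i::finite \<Rightarrow> nat) \<Rightarrow> ('i \<Rightarrow> nat) set" where
  "neighbours n = (\<lambda>i. n(i := n i + 1)) ` UNIV \<union> (\<lambda>i. n(i := n i - 1)) ` {i. n i > 0}"

lemma finite_neighbours [simp]: "finite (neighbours n)"
  by (simp add: neighbours_def)

lemma not_self_neighbour: "n \<notin> neighbours n"
proof -
  have "n \<noteq> n(i := n i + 1)" for i
    by (metis fun_upd_same n_not_Suc_n Suc_eq_plus1)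
  moreover have "n \<noteq> n(i := n i - 1)" if "n i > 0" for i
    using that by (metis fun_upd_same diff_less less_irrefl zero_less_one)
  ultimately show ?thesis by (auto simp: neighbours_def)
qed

lemma transition_rate_outside_neighbours:
  "n' \<notin> neighbours n \<Longrightarrow> transition_rate E lam lamE mu B \<eta> n n' = 0"
  unfolding transition_rate_def
  by (subst (1 2) sum.neutral) (auto simp: neighbours_def)

lemma transition_rate_nonneg:
  assumes "\<And>i. lam i \<ge> 0" "\<And>e. e \<in> E \<Longrightarrow> lamE e \<ge> 0" "\<And>i. mu i > 0"
  shows "transition_rate E lam lamE mu B \<eta> n n' \<ge> 0"
  unfolding transition_rate_def arrival_rate_def using assms
  by (intro add_nonneg_nonneg sum_nonneg) (auto intro!: sum_nonneg add_nonneg_nonneg intro: less_imp_le)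

text \<open>Exchanging the sums over targets and servers leaves one target per server and kind of
  event. With \<open>C\<close> a sublevel set or its complement this yields the rates across a
  cut.\<close>

lemma sum_transition_rate:
  "(\<Sum>n'\<in>neighbours n \<inter> C. transition_rate E lam lamE mu B \<eta> n n') =
    (\<Sum>i | n(i := n i + 1) \<in> C. arrival_rate E lam lamE \<eta> (inv B n) i) +
    (\<Sum>i | n i > 0 \<and> n(i := n i - 1) \<in> C. mu i)"
proof -
  have fin: "finite (neighbours n \<inter> C)" by simp
  have 1: "(\<Sum>n'\<in>neighbours n \<inter> C. if n' = n(i := n i + 1) then c else 0) =
      (if n(i := n i + 1) \<in> C then c else 0)" for i and c :: real
    using fin by (simp add: sum.delta) (auto simp: neighbours_def)
  have 2: "(\<Sum>n'\<in>neighbours n \<inter> C. if n i > 0 \<and> n' = n(i := n i - 1) then c else 0) =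
      (if n i > 0 \<and> n(i := n i - 1) \<in> C then c else 0)" for i and c :: real
  proof (cases "n i > 0")
    case True
    then have "n(i := n i - 1) \<in> neighbours n" by (auto simp: neighbours_def)
    then show ?thesis using fin True by (simp add: sum.delta)
  qed simp
  show ?thesis
    unfolding transition_rate_def sum.distrib
    by (subst (1 2) sum.swap) (simp only: 1 2 sum.inter_filter[OF finite, symmetric] UNIV_I simp_thms)
qed

lemma sum_fun_upd_Suc:
  fixes n :: "'i::finite \<Rightarrow> nat"
  shows "sum (n(i := n i + 1)) S = sum n S + (if i \<in> S then 1 else 0)"
proof -
  have "sum (n(i := n i + 1)) S = (\<Sum>j\<in>S. n j + (if j = i then 1 else 0))"
    by (intro sum.cong) auto
  then show ?thesis by (simp add: sum.distrib)
qed

lemma sum_fun_upd_pred: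
  fixes n :: "'i::finite \<Rightarrow> nat"
  assumes "n i > 0"
  shows "sum n S = sum (n(i := n i - 1)) S + (if i \<in> S then 1 else 0)"
proof -
  define m where "m = n(i := n i - 1)"
  have "n = m(i := m i + 1)" using assms by (auto simp: m_def fun_eq_iff)
  then have "sum n S = sum (m(i := m i + 1)) S" by simp
  then show ?thesis unfolding sum_fun_upd_Suc m_def .
qed

text \<open>In every state a call of a hyperedge inside \<open>S\<close> goes to a server of
  \<open>S\<close> with probability 1; the other hyperedges can only add arrivals.\<close>

lemma demand_le_arrival_rate:
  fixes E :: "'i::finite set set"
  assumes "dispatch_policy E \<eta>" "\<And>e. e \<in> E \<Longrightarrow> lamE e \<ge> 0"
  shows "demand E lam lamE S \<le> (\<Sum>i\<in>S. arrival_rate E lam lamE \<eta> u i)"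
proof -
  have "(\<Sum>e\<in>{e\<in>E. e \<subseteq> S}. lamE e) = (\<Sum>e\<in>{e\<in>E. e \<subseteq> S}. (\<Sum>i\<in>S. pmf (\<eta> e u) i) * lamE e)"
  proof (intro sum.cong refl)
    fix e assume "e \<in> {e\<in>E. e \<subseteq> S}"
    then have "set_pmf (\<eta> e u) \<subseteq> S" using assms(1) by (auto simp: dispatch_policy_def)
    then show "lamE e = (\<Sum>i\<in>S. pmf (\<eta> e u) i) * lamE e" by (simp add: sum_pmf_eq_1)
  qed
  also have "\<dots> \<le> (\<Sum>e\<in>E. (\<Sum>i\<in>S. pmf (\<eta> e u) i) * lamE e)"
    using assms(2) by (intro sum_mono2) (auto intro!: mult_nonneg_nonneg sum_nonneg)
  also have "\<dots> = (\<Sum>i\<in>S. \<Sum>e\<in>E. pmf (\<eta> e u) i * lamE e)"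
    by (subst sum.swap) (simp add: sum_distrib_right)
  finally show ?thesis
    by (simp add: demand_def arrival_rate_def sum.distrib)
qed

text \<open>Cut balance at the sets \<open>{n. sum n S \<le> m}\<close>: they are left only through arrivals to \<open>S\<close>, whose
  total rate is at least \<open>demand S\<close>, and entered only through departures from \<open>S\<close>.\<close>

lemma stationary_level_le:
  fixes E :: "'i::finite set set" and B :: "nat \<Rightarrow> 'i \<Rightarrow> nat"
  assumes "ctmc_semigroup (transition_rate E lam lamE mu B \<eta>) P" "stationary_distribution P \<pi>"
    and "dispatch_policy E \<eta>" "\<And>i. lam i \<ge> 0" "\<And>e. e \<in> E \<Longrightarrow> lamE e \<ge> 0" "\<And>i. mu i > 0"
  shows "demand E lam lamE S * measure \<pi> {n. sum n S = m} \<le> capacity mu S * measure \<pi> {n. sum n S = Suc m}"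
proof -
  let ?q = "transition_rate E lam lamE mu B \<eta>" and ?a = "arrival_rate E lam lamE \<eta>"
  \<comment> \<open>A crude bound on all exit rates: each dispatch probability is replaced by 1 and
    every server is counted as busy.\<close>
  define L where "L = (\<Sum>i\<in>UNIV. lam i + (\<Sum>e\<in>E. lamE e)) + (\<Sum>i\<in>UNIV. mu i)"
  define A where "A = {n. sum n S \<le> m}"
  have L: "(\<Sum>n'\<in>neighbours n. ?q n n') \<le> L" for n
  proof -
    have "?a (inv B n) i \<le> lam i + (\<Sum>e\<in>E. lamE e)" for i
      unfolding arrival_rate_def using assms(5)
      by (intro add_mono sum_mono order_refl mult_left_le_one_le) (auto simp: pmf_le_1)
    then have "(\<Sum>i\<in>UNIV. ?a (inv B n) i) + (\<Sum>i | n i > 0. mu i) \<le> L"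
      unfolding L_def using assms(6) by (intro add_mono sum_mono sum_mono2) (auto intro: less_imp_le)
    then show ?thesis using sum_transition_rate[where n=n and C=UNIV] by simp
  qed
  have up: "(\<Sum>n'\<in>neighbours n - A. ?q n n') = (if sum n S = m then \<Sum>i\<in>S. ?a (inv B n) i else 0)"
    if "n \<in> A" for n
  proof -
    have "{i. n(i := n i + 1) \<in> - A} = (if sum n S = m then S else {})"
      using that sum_fun_upd_Suc[of n _ S] by (auto simp: A_def)
    moreover have "{i. n i > 0 \<and> n(i := n i - 1) \<in> - A} = {}"
      using that sum_fun_upd_pred[where n=n and S=S] by (fastforce simp: A_def)
    ultimately show ?thesis
      unfolding Diff_eq sum_transition_rate by (simp only: sum.empty if_distrib[of "sum _"] add_0_right)
  qed
  have down: "(\<Sum>n'\<in>neighbours n \<inter> A. ?q n n') = (if sum n S = Suc m then \<Sum>i | i \<in> S \<and> n i > 0. mu i else 0)"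
    if "n \<notin> A" for n
  proof -
    have "{i. n(i := n i + 1) \<in> A} = {}"
      using that sum_fun_upd_Suc[of n _ S] by (auto simp: A_def)
    moreover have "n(i := n i - 1) \<in> A \<longleftrightarrow> sum n S = Suc m \<and> i \<in> S" if "n i > 0" for i
      using \<open>n \<notin> A\<close> sum_fun_upd_pred[where n=n and i=i and S=S] that by (auto simp: A_def)
    then have "{i. n i > 0 \<and> n(i := n i - 1) \<in> A} = (if sum n S = Suc m then {i. i \<in> S \<and> n i > 0} else {})"
      by auto
    ultimately show ?thesis
      unfolding sum_transition_rate by (simp only: sum.empty if_distrib[of "sum _"] add_0_left)
  qed
  have q_nonneg: "0 \<le> ?q n n'" for n n'
    using assms(4-6) by (rule transition_rate_nonneg)
  have sub: "0 \<le> (\<Sum>n'\<in>N. ?q n n') \<and> (\<Sum>n'\<in>N. ?q n n') \<le> L" if "N \<subseteq> neighbours n" for n N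
    using L[of n] sum_mono2[OF finite_neighbours that, of "?q n"] q_nonneg
    by (auto intro: sum_nonneg order_trans)
  then have "0 \<le> L" by (meson order_trans empty_subsetI)
  have int: "integrable (measure_pmf \<pi>) (\<lambda>n. indicator C n * (\<Sum>n'\<in>N n. ?q n n'))"
    if "\<And>n. N n \<subseteq> neighbours n" for C N
    using sub[OF that] \<open>0 \<le> L\<close>
    by (intro measure_pmf.integrable_const_bound[where B=L] AE_I2) (auto simp: indicator_def)
  have ind: "integrable (measure_pmf \<pi>) (\<lambda>n. indicator C n * (c::real))" for C c
    by (intro measure_pmf.integrable_const_bound[where B="\<bar>c\<bar>"] AE_I2) (auto simp: indicator_def)
  have "demand E lam lamE S * measure \<pi> {n. sum n S = m}
      = (\<integral>n. indicator {n. sum n S = m} n * demand E lam lamE S \<partial>measure_pmf \<pi>)"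
    by simp
  also have "\<dots> \<le> (\<integral>n. indicator A n * (\<Sum>n'\<in>neighbours n - A. ?q n n') \<partial>measure_pmf \<pi>)"
  proof (intro integral_mono int ind)
    show "indicator {n. sum n S = m} n * demand E lam lamE S
        \<le> indicator A n * (\<Sum>n'\<in>neighbours n - A. ?q n n')" for n
      using up[of n] demand_le_arrival_rate[OF assms(3,5), where lam=lam and S=S and u="inv B n"]
      by (auto simp: indicator_def A_def)
  qed auto
  also have "\<dots> = (\<integral>n. indicator (-A) n * (\<Sum>n'\<in>neighbours n \<inter> A. ?q n n') \<partial>measure_pmf \<pi>)"
    using assms(1,2) finite_neighbours not_self_neighbour transition_rate_outside_neighbours L
    by (rule stationary_cut_balance)
  also have "\<dots> \<le> (\<integral>n. indicator {n. sum n S = Suc m} n * capacity mu S \<partial>measure_pmf \<pi>)"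
  proof (intro integral_mono int ind)
    show "indicator (-A) n * (\<Sum>n'\<in>neighbours n \<inter> A. ?q n n')
        \<le> indicator {n. sum n S = Suc m} n * capacity mu S" for n
    proof -
      \<comment> \<open>Idle servers release no calls, so the capacity only bounds the departure
        rate from above.\<close>
      have "(\<Sum>i | i \<in> S \<and> n i > 0. mu i) \<le> capacity mu S"
        unfolding capacity_def using assms(6) by (intro sum_mono2) (auto intro: less_imp_le)
      then show ?thesis
        using down[of n] by (auto simp: indicator_def A_def)
    qed
  qed auto
  also have "\<dots> = capacity mu S * measure \<pi> {n. sum n S = Suc m}"
    by simp
  finally show ?thesis .
qed

text \<open>From a point of positive mass on, a nondecreasing mass function stays at least that
  large, so finitely many of its values would sum to more than 1.\<close>

lemma pmf_nat_not_incseq: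
  fixes p :: "nat pmf"
  shows "\<exists>m. pmf p (Suc m) < pmf p m"
proof (rule ccontr)
  assume "\<nexists>m. pmf p (Suc m) < pmf p m"
  then have mono: "incseq (pmf p)"
    by (auto intro!: incseq_SucI simp: not_less)
  obtain m where m: "0 < pmf p m"
    using set_pmf_not_empty[of p] by (metis all_not_in_conv pmf_positive)
  obtain k :: nat where k: "1 < real k * pmf p m"
    using ex_less_of_nat_mult[OF m] by blast
  have "real k * pmf p m = (\<Sum>j\<in>{m..<m + k}. pmf p m)" by simp
  also have "\<dots> \<le> (\<Sum>j\<in>{m..<m + k}. pmf p j)"
    by (intro sum_mono) (auto intro: incseqD[OF mono])
  also have "\<dots> \<le> 1"
    by (simp add: measure_measure_pmf_finite[symmetric])
  finally show False using k by simp
qed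

text \<open>Constant level probabilities are as impossible as growing ones, so equality of demand
  and capacity is excluded and the inequality is strict.\<close>

lemma demand_less_capacity_if_stable:
  fixes E :: "'i::finite set set" and B :: "nat \<Rightarrow> 'i \<Rightarrow> nat"
  assumes "stable_policy E lam lamE mu B \<eta>" "dispatch_policy E \<eta>"
    and "\<And>i. lam i \<ge> 0" "\<And>e. e \<in> E \<Longrightarrow> lamE e \<ge> 0" "\<And>i. mu i > 0" "S \<noteq> {}"
  shows "demand E lam lamE S < capacity mu S"
proof (rule ccontr)
  assume "\<not> demand E lam lamE S < capacity mu S"
  then have ge: "capacity mu S \<le> demand E lam lamE S" by simp
  obtain P \<pi> where P: "ctmc_semigroup (transition_rate E lam lamE mu B \<eta>) P" "stationary_distribution P \<pi>"
    using assms(1) by (auto simp: stable_policy_def positive_recurrent_def)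
  have cap: "0 < capacity mu S"
    using assms(5,6) by (rule capacity_pos)
  define p where "p = map_pmf (\<lambda>n. sum n S) \<pi>"
  have p: "pmf p m = measure \<pi> {n. sum n S = m}" for m
    by (simp add: p_def pmf_map vimage_def)
  have "pmf p m \<le> pmf p (Suc m)" for m
  proof -
    have "capacity mu S * pmf p m \<le> demand E lam lamE S * pmf p m"
      using ge by (intro mult_right_mono) auto
    also have "\<dots> \<le> capacity mu S * pmf p (Suc m)"
      unfolding p by (rule stationary_level_le[OF P assms(2-5)])
    finally show ?thesis using cap by simp
  qed
  then show False using pmf_nat_not_incseq[of p] by (meson not_less)
qed

section \<open>Uniformization\<close>

primrec kernel_pow :: "('s \<Rightarrow> 's pmf) \<Rightarrow> nat \<Rightarrow> 's \<Rightarrow> 's pmf" where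
  "kernel_pow K 0 = return_pmf"
| "kernel_pow K (Suc k) = (\<lambda>x. bind_pmf (K x) (kernel_pow K k))"

lemma kernel_pow_add: "kernel_pow K (j + k) = (\<lambda>x. bind_pmf (kernel_pow K j x) (kernel_pow K k))"
  by (induction j) (simp_all add: bind_return_pmf bind_assoc_pmf)

lemma kernel_pow_invariant:
  assumes "bind_pmf \<pi> K = \<pi>"
  shows "bind_pmf \<pi> (kernel_pow K k) = \<pi>"
proof (induction k)
  case (Suc k)
  have "bind_pmf \<pi> (kernel_pow K (Suc k)) = bind_pmf (bind_pmf \<pi> K) (kernel_pow K k)"
    by (simp add: bind_assoc_pmf)
  then show ?case using Suc assms by simp
qed (simp add: bind_return_pmf')

text \<open>Summing detailed balance over \<open>x\<close> leaves \<open>pmf \<pi> y\<close> times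
  the total mass of \<open>K y\<close>. In \<open>ennreal\<close> the sums need no summability
  argument.\<close>

lemma reversible_invariant:
  assumes "\<And>x y. pmf \<pi> x * pmf (K x) y = pmf \<pi> y * pmf (K y) x"
  shows "bind_pmf \<pi> K = \<pi>"
proof (rule pmf_eqI)
  fix y
  have "ennreal (pmf (bind_pmf \<pi> K) y) = (\<integral>\<^sup>+x. ennreal (pmf \<pi> x) * ennreal (pmf (K x) y) \<partial>count_space UNIV)"
    by (simp add: ennreal_pmf_bind nn_integral_measure_pmf)
  also have "\<dots> = (\<integral>\<^sup>+x. ennreal (pmf \<pi> y) * ennreal (pmf (K y) x) \<partial>count_space UNIV)"
    by (simp add: ennreal_mult[symmetric] assms)
  also have "\<dots> = ennreal (pmf \<pi> y)"
    by (simp add: nn_integral_cmult nn_integral_pmf)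
  finally show "pmf (bind_pmf \<pi> K) y = pmf \<pi> y" by simp
qed

section \<open>Poisson mixtures of jump kernels\<close>

text \<open>The event counts of two consecutive time spans add up; the convolution is the binomial
  theorem. This becomes the semigroup law.\<close>

lemma poisson_pmf_add:
  assumes "0 < a" "0 < b"
  shows "bind_pmf (poisson_pmf a) (\<lambda>j. map_pmf ((+) j) (poisson_pmf b)) = poisson_pmf (a + b)"
proof (rule pmf_eqI)
  fix n
  have shift: "pmf (map_pmf ((+) j) (poisson_pmf b)) n = (if j \<le> n then pmf (poisson_pmf b) (n - j) else 0)" for j
  proof (cases "j \<le> n")
    case True
    then have "(+) j -` {n} = {n - j}" by auto
    then show ?thesis using True by (simp add: pmf_map measure_pmf_single)
  next
    case False
    then have "(+) j -` {n} = {}" by auto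
    then show ?thesis using False by (simp add: pmf_map)
  qed
  have exp_sum: "exp (-(a + b)) = exp (-a) * exp (-b)"
    by (simp add: exp_add[symmetric])
  have "pmf (bind_pmf (poisson_pmf a) (\<lambda>j. map_pmf ((+) j) (poisson_pmf b))) n =
      (\<Sum>j\<le>n. pmf (poisson_pmf a) j * pmf (poisson_pmf b) (n - j))"
    unfolding pmf_bind shift
    by (subst integral_measure_pmf[of "{..n}"]) (auto intro!: sum.cong split: if_split_asm)
  also have "\<dots> = (\<Sum>j\<le>n. of_nat (n choose j) * a ^ j * b ^ (n - j)) / fact n * exp (-(a + b))"
    unfolding sum_divide_distrib sum_distrib_right exp_sum using assms
    by (intro sum.cong refl) (simp add: binomial_fact)
  also have "\<dots> = pmf (poisson_pmf (a + b)) n"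
    using assms by (simp add: binomial_ring)
  finally show "pmf (bind_pmf (poisson_pmf a) (\<lambda>j. map_pmf ((+) j) (poisson_pmf b))) n
      = pmf (poisson_pmf (a + b)) n" .
qed

text \<open>To first order in \<open>a\<close> only the value at 1 counts: the value at 0 vanishes,
  and two or more events have probability at most the square of \<open>a\<close>.\<close>

lemma expectation_poisson_approx:
  fixes f :: "nat \<Rightarrow> real"
  assumes "\<And>k. 0 \<le> f k" "\<And>k. f k \<le> 1" "0 < a" "f 0 = 0"
  shows "a * exp (-a) * f 1 \<le> measure_pmf.expectation (poisson_pmf a) f"
    and "measure_pmf.expectation (poisson_pmf a) f \<le> a * exp (-a) * f 1 + a\<^sup>2"
proof -
  let ?M = "measure_pmf (poisson_pmf a)"
  have int: "integrable ?M (\<lambda>k. g k)" if "\<And>k. \<bar>g k\<bar> \<le> 1" for g :: "nat \<Rightarrow> real"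
    using that by (intro measure_pmf.integrable_const_bound[where B=1] AE_I2) auto
  have one: "a * exp (-a) * f 1 = (\<integral>k. indicator {1} k * f 1 \<partial>?M)"
    using assms(3) by (simp add: measure_pmf_single)
  show "a * exp (-a) * f 1 \<le> measure_pmf.expectation (poisson_pmf a) f"
    unfolding one using assms by (intro integral_mono int) (auto simp: indicator_def abs_of_nonneg)
  have "(\<integral>k. f k \<partial>?M) \<le> (\<integral>k. indicator {1} k * f 1 + indicator (-{0,1}) k \<partial>?M)"
    using assms by (intro integral_mono int) (auto simp: indicator_def abs_of_nonneg)
  also have "\<dots> = a * exp (-a) * f 1 + measure ?M (-{0,1})"
    unfolding one using assms(1,2)
    by (subst Bochner_Integration.integral_add) (auto intro!: int simp: indicator_def abs_of_nonneg)
  also have "measure ?M (-{0,1}) = 1 - (1 + a) * exp (-a)"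
    using measure_pmf.prob_compl[of "{0,1}" "poisson_pmf a"] assms(3)
    by (simp add: Compl_eq_Diff_UNIV measure_measure_pmf_finite algebra_simps)
  also have "\<dots> \<le> a\<^sup>2"
  proof -
    \<comment> \<open>\<open>exp (-a)\<close> is at least \<open>1 - a\<close>, and
      \<open>1 - (1 + a) * (1 - a)\<close> is the square of \<open>a\<close>.\<close>
    have "(1 + a) * (1 + (-a)) \<le> (1 + a) * exp (-a)"
      using assms(3) exp_ge_add_one_self[of "-a"] by (intro mult_left_mono) auto
    then show ?thesis by (simp add: algebra_simps power2_eq_square)
  qed
  finally show "measure_pmf.expectation (poisson_pmf a) f \<le> a * exp (-a) * f 1 + a\<^sup>2" by simp
qed

text \<open>For \<open>a = L * t\<close> the error term divided by \<open>t\<close> is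
  \<open>L\<^sup>2 * t\<close>, which vanishes in the limit.\<close>

lemma expectation_poisson_derivative:
  fixes f :: "nat \<Rightarrow> real"
  assumes "\<And>k. 0 \<le> f k" "\<And>k. f k \<le> 1" "0 < L" "f 0 = 0"
  shows "((\<lambda>t. measure_pmf.expectation (poisson_pmf (L * t)) f / t) \<longlongrightarrow> L * f 1) (at_right 0)"
proof (rule tendsto_sandwich)
  let ?g = "\<lambda>t. measure_pmf.expectation (poisson_pmf (L * t)) f"
  show "\<forall>\<^sub>F t in at_right 0. L * exp (- (L * t)) * f 1 \<le> ?g t / t"
    using eventually_at_right_less
  proof (rule eventually_mono)
    fix t :: real assume "0 < t"
    then show "L * exp (- (L * t)) * f 1 \<le> ?g t / t"
      using expectation_poisson_approx(1)[of f "L * t"] assms by (simp add: field_simps)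
  qed
  show "\<forall>\<^sub>F t in at_right 0. ?g t / t \<le> L * exp (- (L * t)) * f 1 + L\<^sup>2 * t"
    using eventually_at_right_less
  proof (rule eventually_mono)
    fix t :: real assume "0 < t"
    then show "?g t / t \<le> L * exp (- (L * t)) * f 1 + L\<^sup>2 * t"
      using expectation_poisson_approx(2)[of f "L * t"] assms by (simp add: field_simps power2_eq_square)
  qed
  have "((\<lambda>t. L * exp (- (L * t)) * f 1) \<longlongrightarrow> L * exp (- (L * 0)) * f 1) (at_right 0)"
    by (intro tendsto_intros)
  then show "((\<lambda>t. L * exp (- (L * t)) * f 1) \<longlongrightarrow> L * f 1) (at_right 0)" by simp
  have "((\<lambda>t. L * exp (- (L * t)) * f 1 + L\<^sup>2 * t) \<longlongrightarrow> L * exp (- (L * 0)) * f 1 + L\<^sup>2 * 0) (at_right 0)"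
    by (intro tendsto_intros)
  then show "((\<lambda>t. L * exp (- (L * t)) * f 1 + L\<^sup>2 * t) \<longlongrightarrow> L * f 1) (at_right 0)" by simp
qed

text \<open>The case distinction is needed because \<^const>\<open>poisson_pmf\<close> is unspecified at rate 0.\<close>

definition uniformized :: "real \<Rightarrow> ('s \<Rightarrow> 's pmf) \<Rightarrow> real \<Rightarrow> 's \<Rightarrow> 's pmf" where
  "uniformized L K t x =
     (if t > 0 then bind_pmf (poisson_pmf (L * t)) (\<lambda>k. kernel_pow K k x) else return_pmf x)"

text \<open>Poisson counts add, kernel powers compose accordingly, and drawing the second count
  commutes with making the first jumps.\<close>

lemma uniformized_add:
  assumes "0 < L" "0 \<le> s" "0 \<le> t"
  shows "uniformized L K (s + t) x = bind_pmf (uniformized L K s x) (uniformized L K t)"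
proof (cases "s = 0 \<or> t = 0")
  case True
  moreover have "uniformized L K 0 = return_pmf" by (auto simp: uniformized_def)
  ultimately show ?thesis by (auto simp: bind_return_pmf bind_return_pmf')
next
  case False
  then have st: "0 < s" "0 < t" using assms by auto
  have "uniformized L K (s + t) x
      = bind_pmf (bind_pmf (poisson_pmf (L * s)) (\<lambda>j. map_pmf ((+) j) (poisson_pmf (L * t)))) (\<lambda>k. kernel_pow K k x)"
    using st assms(1) by (simp add: poisson_pmf_add uniformized_def distrib_left)
  also have "\<dots> = bind_pmf (poisson_pmf (L * s)) (\<lambda>j. bind_pmf (poisson_pmf (L * t))
      (\<lambda>k. bind_pmf (kernel_pow K j x) (kernel_pow K k)))"
    by (simp add: bind_assoc_pmf bind_map_pmf kernel_pow_add)
  also have "\<dots> = bind_pmf (poisson_pmf (L * s)) (\<lambda>j. bind_pmf (kernel_pow K j x)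
      (\<lambda>y. bind_pmf (poisson_pmf (L * t)) (\<lambda>k. kernel_pow K k y)))"
    by (subst bind_commute_pmf) simp
  also have "\<dots> = bind_pmf (uniformized L K s x) (uniformized L K t)"
    using st by (simp add: uniformized_def[abs_def] bind_assoc_pmf)
  finally show ?thesis .
qed

lemma infsum_pmf: "infsum (pmf p) A = measure (measure_pmf p) A"
  by (simp add: measure_pmf_conv_infsetsum infsetsum_infsum pmf_abs_summable)

text \<open>The probabilities of being at \<open>y\<close> and of being away from \<open>x\<close>,
  as functions of the number of jumps, vanish at 0 jumps, so their derivatives at time 0 come from
  one step of \<open>K\<close>. Jumps of \<open>K\<close> from a state to itself make up the
  difference between \<open>L\<close> and the exit rate.\<close>

lemma ctmc_semigroup_uniformized:
  assumes "0 < L" and q: "\<And>x y. x \<noteq> y \<Longrightarrow> q x y = L * pmf (K x) y"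
  shows "ctmc_semigroup q (uniformized L K)"
  unfolding ctmc_semigroup_def
proof (intro conjI allI impI)
  have pos: "\<forall>\<^sub>F t in at_right 0. 0 < (t::real)" by (rule eventually_at_right_less)
  have pmf_unif: "pmf (uniformized L K t x) y = measure_pmf.expectation (poisson_pmf (L * t)) (\<lambda>k. pmf (kernel_pow K k x) y)"
    if "0 < t" for t x y
    using that by (simp add: uniformized_def pmf_bind)
  show "uniformized L K 0 x = return_pmf x" for x by (simp add: uniformized_def)
  show "uniformized L K (s + t) x = bind_pmf (uniformized L K s x) (uniformized L K t)"
    if "0 \<le> s" "0 \<le> t" for s t x
    using assms(1) that by (rule uniformized_add)
  show "((\<lambda>t. pmf (uniformized L K t x) y / t) \<longlongrightarrow> q x y) (at_right 0)" if "x \<noteq> y" for x y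
  proof -
    have "((\<lambda>t. measure_pmf.expectation (poisson_pmf (L * t)) (\<lambda>k. pmf (kernel_pow K k x) y) / t)
        \<longlongrightarrow> L * pmf (kernel_pow K 1 x) y) (at_right 0)"
      using assms(1) that by (intro expectation_poisson_derivative) (auto simp: pmf_le_1)
    then have "((\<lambda>t. pmf (uniformized L K t x) y / t) \<longlongrightarrow> L * pmf (kernel_pow K 1 x) y) (at_right 0)"
      by (rule Lim_transform_eventually) (use pos pmf_unif in \<open>auto elim: eventually_mono\<close>)
    then show ?thesis using q[OF that] by (simp add: bind_return_pmf')
  qed
  show "((\<lambda>t. (1 - pmf (uniformized L K t x) x) / t) \<longlongrightarrow> (\<Sum>\<^sub>\<infinity>y\<in>-{x}. q x y)) (at_right 0)" for x
  proof -
    have 1: "1 - pmf (uniformized L K t x) x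
        = measure_pmf.expectation (poisson_pmf (L * t)) (\<lambda>k. 1 - pmf (kernel_pow K k x) x)" if "0 < t" for t
      unfolding pmf_unif[OF that]
      by (subst Bochner_Integration.integral_diff)
        (auto intro!: measure_pmf.integrable_const_bound[where B=1] simp: pmf_le_1)
    have "((\<lambda>t. measure_pmf.expectation (poisson_pmf (L * t)) (\<lambda>k. 1 - pmf (kernel_pow K k x) x) / t)
        \<longlongrightarrow> L * (1 - pmf (kernel_pow K 1 x) x)) (at_right 0)"
      using assms(1) by (intro expectation_poisson_derivative) (auto simp: pmf_le_1)
    then have "((\<lambda>t. (1 - pmf (uniformized L K t x) x) / t) \<longlongrightarrow> L * (1 - pmf (kernel_pow K 1 x) x)) (at_right 0)"
      by (rule Lim_transform_eventually) (use pos 1 in \<open>auto elim: eventually_mono\<close>)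
    moreover have "(\<Sum>\<^sub>\<infinity>y\<in>-{x}. q x y) = L * (1 - pmf (K x) x)"
    proof -
      have "(\<Sum>\<^sub>\<infinity>y\<in>-{x}. q x y) = (\<Sum>\<^sub>\<infinity>y\<in>-{x}. L * pmf (K x) y)"
        using q by (intro infsum_cong) auto
      also have "\<dots> = L * measure (K x) (-{x})"
        by (simp add: infsum_cmult_right' infsum_pmf)
      also have "measure (K x) (-{x}) = 1 - pmf (K x) x"
        using measure_pmf.prob_compl[of "{x}" "K x"] by (simp add: Compl_eq_Diff_UNIV measure_pmf_single)
      finally show ?thesis .
    qed
    ultimately show ?thesis by (simp add: bind_return_pmf')
  qed
qed

lemma stationary_uniformized:
  assumes "bind_pmf \<pi> K = \<pi>"
  shows "stationary_distribution (uniformized L K) \<pi>"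
  unfolding stationary_distribution_def
proof (intro allI impI)
  fix t :: real assume "0 \<le> t"
  show "bind_pmf \<pi> (uniformized L K t) = \<pi>"
  proof (cases "t = 0")
    case True
    then have "uniformized L K t = return_pmf" by (auto simp: uniformized_def)
    then show ?thesis by (simp add: bind_return_pmf')
  next
    case False
    with \<open>0 \<le> t\<close> have "uniformized L K t = (\<lambda>x. bind_pmf (poisson_pmf (L * t)) (\<lambda>k. kernel_pow K k x))"
      by (auto simp: uniformized_def)
    then have "bind_pmf \<pi> (uniformized L K t)
        = bind_pmf (poisson_pmf (L * t)) (\<lambda>k. bind_pmf \<pi> (kernel_pow K k))"
      by (simp only:) (rule bind_commute_pmf)
    also have "\<dots> = \<pi>" by (simp add: kernel_pow_invariant[OF assms])
    finally show ?thesis .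
  qed
qed

lemma positive_recurrent_reversible:
  assumes "0 < L" "\<And>x y. x \<noteq> y \<Longrightarrow> q x y = L * pmf (K x) y"
    and "\<And>x y. x \<noteq> y \<Longrightarrow> pmf \<pi> x * q x y = pmf \<pi> y * q y x"
  shows "positive_recurrent q"
proof -
  have "pmf \<pi> x * pmf (K x) y = pmf \<pi> y * pmf (K y) x" for x y
  proof (cases "x = y")
    case False
    then show ?thesis using assms(3)[OF False] assms(2)[of x y] assms(2)[of y x] assms(1) by simp
  qed simp
  then have "bind_pmf \<pi> K = \<pi>" by (rule reversible_invariant)
  then have "stationary_distribution (uniformized L K) \<pi>" by (rule stationary_uniformized)
  moreover have "ctmc_semigroup q (uniformized L K)"
    using assms(1,2) by (rule ctmc_semigroup_uniformized)
  ultimately show ?thesis unfolding positive_recurrent_def by (intro exI conjI)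
qed

section \<open>Independent M/M/1 queues\<close>

lemma exists_pmf_with_weights:
  fixes w :: "'a::finite \<Rightarrow> real"
  assumes "\<And>x. 0 \<le> w x" "(\<Sum>x\<in>UNIV. w x) = 1"
  shows "\<exists>p. \<forall>x. pmf p x = w x"
proof -
  have "(\<integral>\<^sup>+x. ennreal (w x) \<partial>count_space UNIV) = 1"
    using assms by (simp add: nn_integral_count_space_finite sum_ennreal)
  then have "pmf (embed_pmf w) x = w x" for x
    using assms(1) by (rule pmf_embed_pmf[rotated])
  then show ?thesis by blast
qed

text \<open>A departure from an empty server changes nothing, by truncated subtraction.\<close>

fun network_event :: "'i + 'i \<Rightarrow> ('i \<Rightarrow> nat) \<Rightarrow> 'i \<Rightarrow> nat" where
  "network_event (Inl i) n = n(i := n i + 1)"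
| "network_event (Inr i) n = n(i := n i - 1)"

lemma pmf_map_network_event:
  fixes p :: "('i::finite + 'i) pmf"
  assumes "n \<noteq> n'"
  shows "pmf (map_pmf (\<lambda>ev. network_event ev n) p) n' =
    (\<Sum>i\<in>UNIV. if n' = n(i := n i + 1) then pmf p (Inl i) else 0) +
    (\<Sum>i\<in>UNIV. if n i > 0 \<and> n' = n(i := n i - 1) then pmf p (Inr i) else 0)"
proof -
  \<comment> \<open>A departure from an empty server leads back to \<open>n\<close>, which differs
    from \<open>n'\<close>, so it drops out of the sum.\<close>
  have departure: "n(i := n i - 1) = n' \<longleftrightarrow> n i > 0 \<and> n' = n(i := n i - 1)" for i
    using assms by (cases "n i = 0") (auto simp: fun_upd_idem)
  have "pmf (map_pmf (\<lambda>ev. network_event ev n) p) n' = (\<Sum>ev | network_event ev n = n'. pmf p ev)"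
    by (simp add: pmf_map vimage_def measure_measure_pmf_finite)
  also have "\<dots> = (\<Sum>ev\<in>UNIV. if network_event ev n = n' then pmf p ev else 0)"
    using sum.inter_filter[of UNIV "pmf p" "\<lambda>ev. network_event ev n = n'"] by simp
  also have "\<dots> = (\<Sum>i\<in>UNIV. if n(i := n i + 1) = n' then pmf p (Inl i) else 0) +
      (\<Sum>i\<in>UNIV. if n(i := n i - 1) = n' then pmf p (Inr i) else 0)"
    unfolding UNIV_Plus_UNIV[symmetric] by (subst sum.Plus) (simp_all add: comp_def)
  finally show ?thesis
    unfolding departure by (simp only: eq_commute[of n'])
qed

text \<open>Only the factor at \<open>i\<close> changes, and one more call multiplies its geometric
  mass by \<open>rho i\<close>.\<close>

lemma pmf_Pi_geometric_upd:
  fixes rho :: "'i::finite \<Rightarrow> real"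
  assumes "\<And>i. 0 \<le> rho i" "\<And>i. rho i < 1"
  shows "pmf (Pi_pmf UNIV d (\<lambda>i. geometric_pmf (1 - rho i))) (n(i := n i + 1))
    = rho i * pmf (Pi_pmf UNIV d (\<lambda>i. geometric_pmf (1 - rho i))) n"
proof -
  have "pmf (Pi_pmf UNIV d (\<lambda>i. geometric_pmf (1 - rho i))) m = (\<Prod>j\<in>UNIV. rho j ^ m j * (1 - rho j))" for m
    using assms by (subst pmf_Pi') (auto intro!: prod.cong)
  moreover have "(\<Prod>j\<in>UNIV - {i}. rho j ^ (n(i := n i + 1)) j * (1 - rho j))
      = (\<Prod>j\<in>UNIV - {i}. rho j ^ n j * (1 - rho j))"
    by (intro prod.cong) auto
  ultimately show ?thesis
    by (simp only: prod.remove[OF finite UNIV_I, of _ i]) simp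
qed

lemma stable_policy_constant_rates:
  fixes E :: "'i::finite set set"
  assumes "\<And>u i. arrival_rate E lam lamE \<eta> u i = a i"
    and "\<And>i. 0 \<le> a i" "\<And>i. a i < mu i"
  shows "stable_policy E lam lamE mu B \<eta>"
proof -
  let ?q = "transition_rate E lam lamE mu B \<eta>"
  have mu_pos: "0 < mu i" for i using assms(2,3)[of i] by linarith
  \<comment> \<open>The total rate of all events, departures from empty servers included, so that
    one event distribution \<open>p\<close> serves every state.\<close>
  define L where "L = (\<Sum>i\<in>UNIV. a i) + (\<Sum>i\<in>UNIV. mu i)"
  have L: "0 < L"
    unfolding L_def using assms(2) mu_pos by (intro add_nonneg_pos sum_nonneg sum_pos) auto
  have "(\<Sum>ev\<in>UNIV. case_sum a mu ev / L) = 1"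
    unfolding UNIV_Plus_UNIV[symmetric] sum_divide_distrib[symmetric]
    using L by (subst sum.Plus) (simp_all add: comp_def L_def)
  moreover have "0 \<le> case_sum a mu ev / L" for ev
    using assms(2) mu_pos L by (auto split: sum.split intro: less_imp_le)
  ultimately obtain p where p: "\<And>ev. pmf p ev = case_sum a mu ev / L"
    using exists_pmf_with_weights[of "\<lambda>ev. case_sum a mu ev / L"] by auto
  define K where "K n = map_pmf (\<lambda>ev. network_event ev n) p" for n
  \<comment> \<open>The factor at \<open>i\<close> is the M/M/1 law, geometric with ratio
    \<open>a i / mu i\<close>.\<close>
  define \<pi> where "\<pi> = Pi_pmf UNIV 0 (\<lambda>i. geometric_pmf (1 - a i / mu i))"
  have up: "mu i * pmf \<pi> (n(i := n i + 1)) = a i * pmf \<pi> n" for n i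
  proof -
    have "pmf \<pi> (n(i := n i + 1)) = a i / mu i * pmf \<pi> n"
      unfolding \<pi>_def using assms(2,3) mu_pos
      by (intro pmf_Pi_geometric_upd) (simp_all add: less_imp_le)
    then show ?thesis using mu_pos[of i] by simp
  qed
  \<comment> \<open>Balance holds move by move: an arrival from \<open>n\<close> to
    \<open>n'\<close> is undone by a departure at the same server. Used for both orders of the two
    states, this gives detailed balance.\<close>
  have flux: "pmf \<pi> n * (\<Sum>i\<in>UNIV. if n' = n(i := n i + 1) then a i else 0)
      = pmf \<pi> n' * (\<Sum>i\<in>UNIV. if n' i > 0 \<and> n = n'(i := n' i - 1) then mu i else 0)" for n n'
    unfolding sum_distrib_left
  proof (intro sum.cong refl)
    fix i
    have iff: "n' = n(i := n i + 1) \<longleftrightarrow> n' i > 0 \<and> n = n'(i := n' i - 1)"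
      by auto
    show "pmf \<pi> n * (if n' = n(i := n i + 1) then a i else 0)
        = pmf \<pi> n' * (if n' i > 0 \<and> n = n'(i := n' i - 1) then mu i else 0)"
      unfolding iff[symmetric] using up[of i n] by (simp add: mult.commute)
  qed
  have q: "?q n n' = (\<Sum>i\<in>UNIV. if n' = n(i := n i + 1) then a i else 0) +
      (\<Sum>i\<in>UNIV. if n i > 0 \<and> n' = n(i := n i - 1) then mu i else 0)" for n n'
    unfolding transition_rate_def by (simp only: assms(1))
  have "?q n n' = L * pmf (K n) n'" if "n \<noteq> n'" for n n'
    unfolding K_def pmf_map_network_event[OF that] q p distrib_left sum_distrib_left
    using L by (intro arg_cong2[of _ _ _ _ "(+)"] sum.cong) auto
  moreover have "pmf \<pi> n * ?q n n' = pmf \<pi> n' * ?q n' n" for n n'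
    unfolding q distrib_left flux[of n n'] flux[of n' n] by simp
  ultimately show ?thesis
    unfolding stable_policy_def using L by (intro positive_recurrent_reversible)
qed

section \<open>From flows to state-independent policies\<close>

text \<open>In every state the calls of \<open>e\<close> are split in the proportions
  \<open>x (e, i) / lamE e\<close>.\<close>

lemma exists_static_policy_of_flow:
  fixes E :: "'i::finite set set"
  assumes "\<And>e. e \<in> E \<Longrightarrow> e \<noteq> {}" and x: "x \<in> flow_polytope E lamE"
  shows "\<exists>\<eta>. dispatch_policy E \<eta> \<and> state_independent E \<eta> \<and>
    (\<forall>u i. arrival_rate E lam lamE \<eta> u i = flow_load E lam x i)"
proof -
  have nonneg: "0 \<le> x (e, i)" if "e \<in> E" "i \<in> e" for e i
    using x that by (auto simp: flow_polytope_def PiE_iff)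
  have total: "(\<Sum>i\<in>e. x (e, i)) = lamE e" if "e \<in> E" for e
    using x that by (auto simp: flow_polytope_def)
  have "\<exists>p. set_pmf p \<subseteq> e \<and> (\<forall>i. pmf p i * lamE e = (if i \<in> e then x (e, i) else 0))" if e: "e \<in> E" for e
  proof (cases "lamE e = 0")
    \<comment> \<open>A hyperedge without calls carries zero flow and gives no proportions; a point
      mass at any of its servers will do.\<close>
    case True
    obtain i where i: "i \<in> e" using assms(1)[OF e] by auto
    have "x (e, j) = 0" if "j \<in> e" for j
      using total[OF e] True nonneg[OF e] that sum_nonneg_eq_0_iff[of e "\<lambda>i. x (e, i)"] by auto
    then show ?thesis using True i by (intro exI[of _ "return_pmf i"]) auto
  next
    case False
    have pos: "0 < lamE e"
      using total[OF e] False sum_nonneg[of e "\<lambda>i. x (e, i)"] nonneg[OF e] by auto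
    define w where "w i = (if i \<in> e then x (e, i) / lamE e else 0)" for i
    have "(\<Sum>i\<in>UNIV. w i) = (\<Sum>i\<in>e. x (e, i) / lamE e)"
      unfolding w_def by (simp add: sum.If_cases)
    also have "\<dots> = 1"
      using pos total[OF e] by (simp add: sum_divide_distrib[symmetric])
    finally have "(\<Sum>i\<in>UNIV. w i) = 1" .
    moreover have "0 \<le> w i" for i using pos nonneg[OF e] by (simp add: w_def)
    ultimately obtain p where p: "\<And>i. pmf p i = w i"
      using exists_pmf_with_weights[of w] by blast
    then show ?thesis
      using pos by (intro exI[of _ p]) (auto simp: w_def set_pmf_iff split: if_splits)
  qed
  then obtain p where p: "\<And>e. e \<in> E \<Longrightarrow> set_pmf (p e) \<subseteq> e"
    "\<And>e i. e \<in> E \<Longrightarrow> pmf (p e) i * lamE e = (if i \<in> e then x (e, i) else 0)"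
    by metis
  have "(\<Sum>e\<in>E. pmf (p e) i * lamE e) = (\<Sum>e\<in>{e\<in>E. i \<in> e}. x (e, i))" for i
    using p(2) by (simp add: sum.inter_filter)
  then show ?thesis
    using p(1) by (intro exI[of _ "\<lambda>e u. p e"])
      (auto simp: dispatch_policy_def state_independent_def arrival_rate_def flow_load_def)
qed

theorem theorem2:
  fixes E :: "'i::finite set set"
    and lam :: "'i \<Rightarrow> real" and lamE :: "'i set \<Rightarrow> real" and mu :: "'i \<Rightarrow> real"
    and B :: "nat \<Rightarrow> 'i \<Rightarrow> nat"
  assumes "\<And>e. e \<in> E \<Longrightarrow> e \<noteq> {}"
    and "\<And>e e'. e \<in> E \<Longrightarrow> e' \<in> E \<Longrightarrow> e \<noteq> e' \<Longrightarrow> \<not> e \<subseteq> e'"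
    and "\<And>i. lam i \<ge> 0"
    and "\<And>e. e \<in> E \<Longrightarrow> lamE e \<ge> 0"
    and "\<And>i. mu i > 0"
    and "bij B"
  defines "\<theta> \<equiv> min_peak_workload E lam lamE mu"
  shows "((\<exists>x\<in>flow_polytope E lamE. peak_workload E lam mu x = \<theta>) \<and>
          (\<forall>x\<in>flow_polytope E lamE. \<theta> \<le> peak_workload E lam mu x)) \<and>
    \<theta> = (MAX S\<in>{S. S \<noteq> {}}. demand E lam lamE S / capacity mu S) \<and>
    ((\<exists>\<eta>. dispatch_policy E \<eta> \<and> stable_policy E lam lamE mu B \<eta>) \<longleftrightarrow>
     (\<exists>\<eta>. dispatch_policy E \<eta> \<and> state_independent E \<eta> \<and> stable_policy E lam lamE mu B \<eta>)) \<and>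
    ((\<exists>\<eta>. dispatch_policy E \<eta> \<and> state_independent E \<eta> \<and> stable_policy E lam lamE mu B \<eta>) \<longleftrightarrow>
     \<theta> < 1) \<and>
    (\<theta> < 1 \<longleftrightarrow> (\<forall>S. S \<noteq> {} \<longrightarrow> demand E lam lamE S < capacity mu S))"
proof -
  have min_attained: "\<exists>x\<in>flow_polytope E lamE. peak_workload E lam mu x = \<theta>"
    unfolding \<theta>_def by (rule min_peak_workload_eq(2)) (fact assms)+
  have min_le: "\<forall>x\<in>flow_polytope E lamE. \<theta> \<le> peak_workload E lam mu x"
    unfolding \<theta>_def
  proof
    fix x assume "x \<in> flow_polytope E lamE"
    show "min_peak_workload E lam lamE mu \<le> peak_workload E lam mu x"
      by (rule min_peak_workload_eq(3)) (fact assms \<open>x \<in> flow_polytope E lamE\<close>)+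
  qed
  have dual: "\<theta> = (MAX S\<in>{S. S \<noteq> {}}. demand E lam lamE S / capacity mu S)"
    unfolding \<theta>_def by (rule min_peak_workload_eq(1)) (fact assms)+
  have ne: "{S. S \<noteq> {}} \<noteq> ({} :: 'i set set)" by blast
  have "\<theta> < 1 \<longleftrightarrow> (\<forall>S. S \<noteq> {} \<longrightarrow> demand E lam lamE S / capacity mu S < 1)"
    unfolding dual using ne by (subst Max_less_iff) auto
  also have "\<dots> \<longleftrightarrow> (\<forall>S. S \<noteq> {} \<longrightarrow> demand E lam lamE S < capacity mu S)"
    using capacity_pos[of mu, OF assms(5)] by (auto simp: pos_divide_less_eq)
  finally have subcritical: "\<theta> < 1 \<longleftrightarrow> (\<forall>S. S \<noteq> {} \<longrightarrow> demand E lam lamE S < capacity mu S)" .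
  have necessary: "demand E lam lamE S < capacity mu S"
    if "dispatch_policy E \<eta>" "stable_policy E lam lamE mu B \<eta>" "S \<noteq> {}" for \<eta> S
    by (rule demand_less_capacity_if_stable) (fact that assms)+
  have sufficient: "\<exists>\<eta>. dispatch_policy E \<eta> \<and> state_independent E \<eta> \<and> stable_policy E lam lamE mu B \<eta>"
    if "\<theta> < 1"
  proof -
    obtain x where x: "x \<in> flow_polytope E lamE" "peak_workload E lam mu x = \<theta>"
      using min_attained by blast
    obtain \<eta> where \<eta>: "dispatch_policy E \<eta>" "state_independent E \<eta>"
      "\<And>u i. arrival_rate E lam lamE \<eta> u i = flow_load E lam x i"
      using exists_static_policy_of_flow[of E x lamE lam] assms(1) x(1) by blast
    have "stable_policy E lam lamE mu B \<eta>"
    proof (rule stable_policy_constant_rates[OF \<eta>(3)])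
      fix i
      show "0 \<le> flow_load E lam x i"
        using x(1) assms(3) unfolding flow_load_def flow_polytope_def
        by (auto intro!: add_nonneg_nonneg sum_nonneg simp: PiE_iff)
      have "flow_load E lam x i / mu i \<le> peak_workload E lam mu x"
        unfolding peak_workload_def by (rule Max_ge) auto
      then have "flow_load E lam x i / mu i < 1" using x(2) that by simp
      then show "flow_load E lam x i < mu i" using assms(5)[of i] by (simp add: pos_divide_less_eq)
    qed
    then show ?thesis using \<eta> by blast
  qed
  show ?thesis
    \<comment> \<open>The implications close a cycle: a state-independent policy is a policy,
      \<open>necessary\<close> and \<open>subcritical\<close> lead to \<open>\<theta> < 1\<close>,
      and \<open>sufficient\<close> leads back.\<close>
    using min_attained min_le dual subcritical necessary sufficient by blast
qed

end
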